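(* Let $\mathrm{Br}$ be the best response function, $(\alpha_i)_{i\ge1}$ the agents' parameters, $P_n$ the empirical distribution of $\{\alpha_i\}_{i=1}^n$ and $P$ its limit as described in the context, with $\mathrm{Br}$ Lipschitz in $z$ with constant $L_z<1$ and Lipschitz in $\alpha$ with constant $L$. Let $z^\star_{\rm AEM}$ be the asymptotic equilibrium mean and let $\hat z^\star_{n,\rm AEM}$ be the $P_n(\alpha)$-based approximation of $z^\star_{\rm AEM}$, i.e. the solution of $\hat z^\star_{n,\rm AEM}=\frac1n\sum_{i=1}^n\mathrm{Br}(\hat z^\star_{n,\rm AEM},\alpha_i)$. Then $$\left|\hat z^\star_{n,\rm AEM}-z^\star_{\rm AEM}\right|\le\frac{L}{1-L_z}\,\mathsf{E}_{\nu,\hat\nu_n}\left[\left|\nu-\hat\nu_n\right|\right],$$ where $\nu$ and $\hat\nu_n$ are two independent random variables distributed according to $P$ and $P_n$, respectively.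
   Context: Let $n\ge 2$, let $a\le b$ be reals, $u:[a,b]\times\mathbb{R}\times\mathbb{R}\to\mathbb{R}$ a utility function $u(x,z,\alpha)$ (action $x$, mean of the other agents' actions $z$, parameter $\alpha$), and $(\alpha_i)_{i\ge1}$ a deterministic sequence of reals (the agents' parameters). Best response. $\mathrm{Br}(z,\alpha)=\arg\max_{a\le x\le b}u(x,z,\alpha)$; for all $z,\alpha\in\mathbb{R}$ the maximizer is assumed to exist and be unique, so $\mathrm{Br}:\mathbb{R}\times\mathbb{R}\to[a,b]$ is a function. Assumptions. (1) There is a constant $0<L_z<1$ with $|\mathrm{Br}(z,\alpha)-\mathrm{Br}(z',\alpha)|\le L_z|z-z'|$ for all $z,z',\alpha\in\mathbb{R}$. (2) There is a constant $L>0$ with $|\mathrm{Br}(z,\alpha)-\mathrm{Br}(z,\alpha')|\le L|\alpha-\alpha'|$ for all $z,\alpha,\alpha'\in\mathbb{R}$. (3) With $P_n(\alpha)=\frac1n\sum_{i=1}^n \mathbf{1}\{\alpha_i\le\alpha\}$, there is a continuous (probability) distribution function $P$ such that $\lim_{n\to\infty}P_n(\alpha)=P(\alpha)$ for all $\alpha\in\mathbb{R}$. Asymptotic equilibrium mean. $z^\star_{\rm AEM}$ is the (unique) solution $z$ of $z=\int_{-\infty}^{\infty}\mathrm{Br}(z,\alpha)\,dP(\alpha)$. $P_n(\alpha)$-based approximation. $\hat z^\star_{n,\rm AEM}$ is the (unique) solution $z$ of $z=\frac1n\sum_{i=1}^n\mathrm{Br}(z,\alpha_i)=\mathsf{E}_{\hat\nu_n}[\mathrm{Br}(z,\hat\nu_n)]$,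 with $\hat\nu_n\sim P_n$. *)

theory Defs
  imports "HOL-Probability.Probability"
begin

definition best_response ::
    "real \<Rightarrow> real \<Rightarrow> (real \<Rightarrow> real \<Rightarrow> real \<Rightarrow> real) \<Rightarrow> real \<Rightarrow> real \<Rightarrow> real" where
  "best_response a b u z \<alpha> = arg_max_on (\<lambda>x. u x z \<alpha>) {a..b}"

definition distribution_function :: "(real \<Rightarrow> real) \<Rightarrow> bool" where
  "distribution_function P \<longleftrightarrow>
     mono P \<and> (\<forall>x. continuous (at_right x) P) \<and>
     (P \<longlongrightarrow> 0) at_bot \<and> (P \<longlongrightarrow> 1) at_top"

text \<open>Agents are numbered from 1; the value at index 0 of a parameter sequence is never used.\<close>

definition empirical_df :: "(nat \<Rightarrow> real) \<Rightarrow> nat \<Rightarrow> real \<Rightarrow> real" where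
  "empirical_df \<alpha>s n \<alpha> = (1 / real n) * (\<Sum>i=1..n. of_bool (\<alpha>s i \<le> \<alpha>))"

text \<open>Here \<open>interval_measure P\<close> is the Lebesgue--Stieltjes measure of \<open>P\<close>. If the best response is
  Lipschitz in both arguments, with constant less than 1 in \<open>z\<close>, the two fixed-point equations
  below have exactly one solution by Banach's theorem, so the descriptions are proper.\<close>

definition z_AEM :: "(real \<Rightarrow> real \<Rightarrow> real) \<Rightarrow> (real \<Rightarrow> real) \<Rightarrow> real" where
  "z_AEM Br P = (THE z. z = (\<integral>\<alpha>. Br z \<alpha> \<partial>interval_measure P))"

definition z_AEM_hat :: "(real \<Rightarrow> real \<Rightarrow> real) \<Rightarrow> (nat \<Rightarrow> real) \<Rightarrow> nat \<Rightarrow> real" where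
  "z_AEM_hat Br \<alpha>s n = (THE z. z = (1 / real n) * (\<Sum>i=1..n. Br z (\<alpha>s i)))"

end

theory Submission
  imports Defs
begin

text \<open>
  Both equilibrium means are fixed points of a mean response: writing
  \<open>F z = E[Br z \<nu>]\<close> and \<open>G z = E[Br z \<nu>_hat]\<close>, the asymptotic mean solves \<open>z = F z\<close> and the
  approximation solves \<open>z = G z\<close>, because \<open>\<nu>\<close> has law \<open>P\<close> and \<open>\<nu>_hat\<close> is distributed as a
  uniformly chosen parameter. Averaging preserves Lipschitz constants, so \<open>F\<close> and \<open>G\<close> are
  contractions with constant \<open>L_z\<close>, and by Banach's theorem each has exactly one fixed point
  (\<open>mean_fixed_point_ex1\<close>).

  For the bound, let \<open>x = G x\<close> and \<open>y = F y\<close>. Then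
  \<open>\<bar>x - y\<bar> \<le> \<bar>G x - G y\<bar> + \<bar>G y - F y\<bar> \<le> L_z * \<bar>x - y\<bar> + E \<bar>Br y \<nu>_hat - Br y \<nu>\<bar>\<close>.
  Absorbing the first term on the left gives the factor \<open>1 / (1 - L_z)\<close>
  (\<open>mean_fixed_point_stable\<close>), and the Lipschitz condition in the parameter bounds the
  last expectation by \<open>L * E \<bar>\<nu> - \<nu>_hat\<bar>\<close>, the two variables being
  compared outcome by outcome on their common probability space.
\<close>

lemma (in prob_space) mean_lipschitz:
  fixes g :: "real \<Rightarrow> 'a \<Rightarrow> real"
  assumes "\<And>z. integrable M (g z)"
    and "\<And>z z' \<omega>. \<bar>g z \<omega> - g z' \<omega>\<bar> \<le> c * \<bar>z - z'\<bar>"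
  shows "\<bar>(\<integral>\<omega>. g z \<omega> \<partial>M) - (\<integral>\<omega>. g z' \<omega> \<partial>M)\<bar> \<le> c * \<bar>z - z'\<bar>"
proof -
  have "\<bar>(\<integral>\<omega>. g z \<omega> \<partial>M) - (\<integral>\<omega>. g z' \<omega> \<partial>M)\<bar> = \<bar>\<integral>\<omega>. g z \<omega> - g z' \<omega> \<partial>M\<bar>"
    using assms(1) by simp
  also have "\<dots> \<le> (\<integral>\<omega>. \<bar>g z \<omega> - g z' \<omega>\<bar> \<partial>M)"
    by (rule integral_abs_bound)
  also have "\<dots> \<le> (\<integral>\<omega>. c * \<bar>z - z'\<bar> \<partial>M)"
    by (intro integral_mono integrable_abs Bochner_Integration.integrable_diff assms) simp
  finally show ?thesis
    by (simp add: prob_space)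
qed

lemma (in prob_space) mean_fixed_point_ex1:
  fixes g :: "real \<Rightarrow> 'a \<Rightarrow> real"
  assumes "0 \<le> c" "c < 1"
    and "\<And>z. integrable M (g z)"
    and "\<And>z z' \<omega>. \<bar>g z \<omega> - g z' \<omega>\<bar> \<le> c * \<bar>z - z'\<bar>"
  shows "\<exists>!z. z = (\<integral>\<omega>. g z \<omega> \<partial>M)"
proof -
  have "\<exists>!z. (\<integral>\<omega>. g z \<omega> \<partial>M) = z"
    by (rule banach_fix_type[OF assms(1,2)])
      (use mean_lipschitz[OF assms(3,4)] in \<open>simp add: dist_real_def\<close>)
  then show ?thesis
    by (simp only: eq_commute)
qed

text \<open>
  Inserting the mean of \<open>g y\<close> between \<open>x\<close> and \<open>y\<close> splits their distance into a contracted copy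
  of itself and the difference between \<open>g\<close> and \<open>h\<close>. Inserting the mean of \<open>h x\<close> instead would
  give the same kind of bound, but with the difference taken at \<open>x\<close> and \<open>h\<close> contracting.
\<close>

lemma (in prob_space) mean_fixed_point_stable:
  fixes g h :: "real \<Rightarrow> 'a \<Rightarrow> real"
  assumes "c < 1"
    and g: "\<And>z. integrable M (g z)"
    and h: "integrable M (h y)"
    and lip: "\<And>z z' \<omega>. \<bar>g z \<omega> - g z' \<omega>\<bar> \<le> c * \<bar>z - z'\<bar>"
    and x: "x = (\<integral>\<omega>. g x \<omega> \<partial>M)"
    and y: "y = (\<integral>\<omega>. h y \<omega> \<partial>M)"
  shows "\<bar>x - y\<bar> \<le> 1 / (1 - c) * (\<integral>\<omega>. \<bar>g y \<omega> - h y \<omega>\<bar> \<partial>M)"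
proof -
  have "\<bar>x - y\<bar> \<le> \<bar>(\<integral>\<omega>. g x \<omega> \<partial>M) - (\<integral>\<omega>. g y \<omega> \<partial>M)\<bar>
      + \<bar>(\<integral>\<omega>. g y \<omega> \<partial>M) - (\<integral>\<omega>. h y \<omega> \<partial>M)\<bar>"
    using x y by linarith
  also have "\<dots> \<le> c * \<bar>x - y\<bar> + (\<integral>\<omega>. \<bar>g y \<omega> - h y \<omega>\<bar> \<partial>M)"
  proof (rule add_mono[OF mean_lipschitz[OF g lip]])
    have "(\<integral>\<omega>. g y \<omega> \<partial>M) - (\<integral>\<omega>. h y \<omega> \<partial>M) = (\<integral>\<omega>. g y \<omega> - h y \<omega> \<partial>M)"
      using g h by simp
    then show "\<bar>(\<integral>\<omega>. g y \<omega> \<partial>M) - (\<integral>\<omega>. h y \<omega> \<partial>M)\<bar> \<le> (\<integral>\<omega>. \<bar>g y \<omega> - h y \<omega>\<bar> \<partial>M)"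
      by (simp only: integral_abs_bound)
  qed
  finally show ?thesis
    using \<open>c < 1\<close> by (simp add: field_simps)
qed

text \<open>
  A distribution function determines its law, and \<open>empirical_df \<alpha>s n\<close> is the one of \<open>\<alpha>s i\<close> for
  an index \<open>i\<close> drawn uniformly from \<open>1, \<dots>, n\<close>. Drawing the index, not the value, counts repeated
  parameters with the right multiplicity.
\<close>

lemma (in prob_space) expectation_empirical:
  fixes X :: "'a \<Rightarrow> real" and f :: "real \<Rightarrow> real"
  assumes "0 < n"
    and X: "X \<in> borel_measurable M"
    and cdf: "cdf (distr M borel X) = empirical_df \<alpha>s n"
    and f: "f \<in> borel_measurable borel"
  shows "(\<integral>\<omega>. f (X \<omega>) \<partial>M) = (1 / real n) * (\<Sum>i=1..n. f (\<alpha>s i))"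
proof -
  let ?U = "measure_pmf (pmf_of_set {1..n})"
  have "cdf (distr ?U borel \<alpha>s) t = empirical_df \<alpha>s n t" for t
  proof -
    have "cdf (distr ?U borel \<alpha>s) t = measure ?U {i. \<alpha>s i \<le> t}"
      by (simp add: cdf_def measure_distr vimage_def)
    also have "\<dots> = card ({1..n} \<inter> {i. \<alpha>s i \<le> t}) / n"
      using \<open>0 < n\<close> by (simp add: measure_pmf_of_set)
    also have "\<dots> = empirical_df \<alpha>s n t"
      by (simp add: empirical_df_def Int_def)
    finally show ?thesis .
  qed
  then have "distr M borel X = distr ?U borel \<alpha>s"
    using X by (intro cdf_unique real_distribution_distr
        prob_space.real_distribution_distr[OF prob_space_measure_pmf])
      (auto simp: cdf)
  then have "(\<integral>\<omega>. f (X \<omega>) \<partial>M) = (\<integral>t. f t \<partial>distr ?U borel \<alpha>s)"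
    using integral_distr[OF X f] by simp
  also have "\<dots> = (\<integral>i. f (\<alpha>s i) \<partial>?U)"
    by (rule integral_distr[OF _ f]) simp
  also have "\<dots> = (1 / real n) * (\<Sum>i=1..n. f (\<alpha>s i))"
    using \<open>0 < n\<close> by (simp add: integral_pmf_of_set)
  finally show ?thesis .
qed

lemma (in prob_space) expectation_interval_measure:
  fixes X f :: "_ \<Rightarrow> real"
  assumes X: "X \<in> borel_measurable M"
    and "distribution_function P"
    and cdf: "cdf (distr M borel X) = P"
    and f: "f \<in> borel_measurable borel"
  shows "(\<integral>\<omega>. f (X \<omega>) \<partial>M) = (\<integral>t. f t \<partial>interval_measure P)"
proof -
  have P: "\<And>x y. x \<le> y \<Longrightarrow> P x \<le> P y" "\<And>x. continuous (at_right x) P"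
      "(P \<longlongrightarrow> 0) at_bot" "(P \<longlongrightarrow> 1) at_top"
    using assms(2) by (auto simp: distribution_function_def mono_def)
  have "distr M borel X = interval_measure P"
    using X P by (intro cdf_unique real_distribution_distr real_distribution_interval_measure)
      (auto simp: cdf cdf_interval_measure)
  then show ?thesis
    using integral_distr[OF X f] by simp
qed

lemma best_response_in_interval:
  assumes "\<exists>x. is_arg_max (\<lambda>x. u x z \<alpha>) (\<lambda>x. x \<in> {a..b}) x"
  shows "best_response a b u z \<alpha> \<in> {a..b}"
  using someI_ex[OF assms]
  by (simp add: best_response_def arg_max_on_def arg_max_def is_arg_max_def)

theorem proposition2:
  fixes a b L_z L :: real
    and u :: "real \<Rightarrow> real \<Rightarrow> real \<Rightarrow> real"
    and Br :: "real \<Rightarrow> real \<Rightarrow> real"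
    and \<alpha>s :: "nat \<Rightarrow> real"
    and P :: "real \<Rightarrow> real"
    and n :: nat
    and M :: "'w measure"
    and \<nu> \<nu>_hat :: "'w \<Rightarrow> real"
  assumes "n \<ge> 2" and "a \<le> b"
    and unique_maximizer:
      "\<And>z \<alpha>. \<exists>!x. is_arg_max (\<lambda>x. u x z \<alpha>) (\<lambda>x. x \<in> {a..b}) x"
    and Br: "Br = best_response a b u"
    and "0 < L_z" and "L_z < 1"
    and Lipschitz_z: "\<And>z z' \<alpha>. \<bar>Br z \<alpha> - Br z' \<alpha>\<bar> \<le> L_z * \<bar>z - z'\<bar>"
    and "0 < L"
    and Lipschitz_\<alpha>: "\<And>z \<alpha> \<alpha>'. \<bar>Br z \<alpha> - Br z \<alpha>'\<bar> \<le> L * \<bar>\<alpha> - \<alpha>'\<bar>"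
    and "distribution_function P" and "continuous_on UNIV P"
    and "\<And>\<alpha>. (\<lambda>m. empirical_df \<alpha>s m \<alpha>) \<longlonglongrightarrow> P \<alpha>"
    and "prob_space M"
    and indep: "prob_space.indep_var M borel \<nu> borel \<nu>_hat"
    and "cdf (distr M borel \<nu>) = P"
    and "cdf (distr M borel \<nu>_hat) = empirical_df \<alpha>s n"
  shows "ennreal \<bar>z_AEM_hat Br \<alpha>s n - z_AEM Br P\<bar>
           \<le> ennreal (L / (1 - L_z)) * (\<integral>\<^sup>+\<omega>. ennreal \<bar>\<nu> \<omega> - \<nu>_hat \<omega>\<bar> \<partial>M)"
proof -
  interpret prob_space M by fact
  have X: "\<nu> \<in> borel_measurable M" and Y: "\<nu>_hat \<in> borel_measurable M"
    using indep_var_rv1[OF indep] indep_var_rv2[OF indep] by auto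
  have meas: "Br z \<in> borel_measurable borel" for z
  proof (rule borel_measurable_continuous_onI)
    show "continuous_on UNIV (Br z)"
      using lipschitz_on_continuous_on[of L UNIV "Br z"] Lipschitz_\<alpha> \<open>0 < L\<close>
      by (auto simp: lipschitz_on_def dist_real_def)
  qed
  have "Br z \<alpha> \<in> {a..b}" for z \<alpha>
    unfolding Br by (rule best_response_in_interval) (use unique_maximizer in blast)
  then have bounded: "\<bar>Br z \<alpha>\<bar> \<le> max \<bar>a\<bar> \<bar>b\<bar>" for z \<alpha>
    by (smt (verit) atLeastAtMost_iff)
  have integrable: "integrable M (\<lambda>\<omega>. Br z (Z \<omega>))" if "Z \<in> borel_measurable M" for z Z
    using measurable_compose[OF that meas] bounded
    by (intro integrable_const_bound[where B = "max \<bar>a\<bar> \<bar>b\<bar>"]) auto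
  have ex1: "\<exists>!z. z = (\<integral>\<omega>. Br z (Z \<omega>) \<partial>M)" if "Z \<in> borel_measurable M" for Z
    using mean_fixed_point_ex1[of L_z "\<lambda>z \<omega>. Br z (Z \<omega>)"] \<open>0 < L_z\<close> \<open>L_z < 1\<close>
      integrable[OF that] Lipschitz_z by simp
  define x where "x = z_AEM_hat Br \<alpha>s n"
  define y where "y = z_AEM Br P"
  have x: "x = (\<integral>\<omega>. Br x (\<nu>_hat \<omega>) \<partial>M)"
  proof -
    have "x = (THE z. z = (\<integral>\<omega>. Br z (\<nu>_hat \<omega>) \<partial>M))"
      using expectation_empirical[OF _ Y assms(16) meas] \<open>n \<ge> 2\<close>
      by (simp add: x_def z_AEM_hat_def)
    then show ?thesis
      using theI'[OF ex1[OF Y]] by simp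
  qed
  have y: "y = (\<integral>\<omega>. Br y (\<nu> \<omega>) \<partial>M)"
  proof -
    have "y = (THE z. z = (\<integral>\<omega>. Br z (\<nu> \<omega>) \<partial>M))"
      using expectation_interval_measure[OF X assms(10,15) meas]
      by (simp add: y_def z_AEM_def)
    then show ?thesis
      using theI'[OF ex1[OF X]] by simp
  qed
  have "\<bar>x - y\<bar> \<le> 1 / (1 - L_z) * (\<integral>\<omega>. \<bar>Br y (\<nu>_hat \<omega>) - Br y (\<nu> \<omega>)\<bar> \<partial>M)"
    by (rule mean_fixed_point_stable[where g = "\<lambda>z \<omega>. Br z (\<nu>_hat \<omega>)" and h = "\<lambda>z \<omega>. Br z (\<nu> \<omega>)"])
      (use \<open>L_z < 1\<close> integrable X Y Lipschitz_z x y in auto)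
  then have "ennreal \<bar>x - y\<bar>
      \<le> ennreal (1 / (1 - L_z)) * ennreal (\<integral>\<omega>. \<bar>Br y (\<nu>_hat \<omega>) - Br y (\<nu> \<omega>)\<bar> \<partial>M)"
    using \<open>L_z < 1\<close> by (subst ennreal_mult[symmetric]) (auto intro: ennreal_leI)
  \<comment> \<open>Only now pass to the extended integral: the response gap is bounded and hence integrable,
    whereas \<open>\<nu> - \<nu>_hat\<close> may have infinite mean, in which case the claim is trivial.\<close>
  also have "ennreal (\<integral>\<omega>. \<bar>Br y (\<nu>_hat \<omega>) - Br y (\<nu> \<omega>)\<bar> \<partial>M)
      = (\<integral>\<^sup>+\<omega>. ennreal \<bar>Br y (\<nu>_hat \<omega>) - Br y (\<nu> \<omega>)\<bar> \<partial>M)"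
    using integrable X Y by (intro nn_integral_eq_integral[symmetric]) auto
  also have "\<dots> \<le> (\<integral>\<^sup>+\<omega>. ennreal L * ennreal \<bar>\<nu> \<omega> - \<nu>_hat \<omega>\<bar> \<partial>M)"
  proof (rule nn_integral_mono)
    fix \<omega>
    have "\<bar>Br y (\<nu>_hat \<omega>) - Br y (\<nu> \<omega>)\<bar> \<le> L * \<bar>\<nu> \<omega> - \<nu>_hat \<omega>\<bar>"
      using Lipschitz_\<alpha>[of y "\<nu>_hat \<omega>" "\<nu> \<omega>"] by (simp add: abs_minus_commute)
    then show "ennreal \<bar>Br y (\<nu>_hat \<omega>) - Br y (\<nu> \<omega>)\<bar> \<le> ennreal L * ennreal \<bar>\<nu> \<omega> - \<nu>_hat \<omega>\<bar>"
      using \<open>0 < L\<close> by (subst ennreal_mult[symmetric]) (auto intro: ennreal_leI)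
  qed
  also have "\<dots> = ennreal L * (\<integral>\<^sup>+\<omega>. ennreal \<bar>\<nu> \<omega> - \<nu>_hat \<omega>\<bar> \<partial>M)"
    using X Y by (intro nn_integral_cmult) measurable
  also have "ennreal (1 / (1 - L_z)) * \<dots>
      = ennreal (L / (1 - L_z)) * (\<integral>\<^sup>+\<omega>. ennreal \<bar>\<nu> \<omega> - \<nu>_hat \<omega>\<bar> \<partial>M)"
    using \<open>0 < L\<close> \<open>L_z < 1\<close>
    by (simp add: mult.assoc[symmetric] ennreal_mult[symmetric])
  finally show ?thesis
    by (simp add: x_def y_def mult_left_mono)
qed

end
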